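(* Let $m\ge1$ be an integer, let $\alpha\ge1$, and put $R=\max\{2,\ \alpha,\ 1+\frac2\alpha\}$ and $r=\max\{\alpha,\ 1+\frac1\alpha\}$. If $R\le 2r$, then there is a (deterministic) online algorithm for scheduling with uncertain processing times on $m$ machines, with the objective of minimizing the total completion time, that is $$\left(\max\left\{2,\ \alpha,\ 1+\tfrac2\alpha\right\}\cdot\left(\tfrac12+\tfrac1{2m}\right)+\max\left\{\alpha,\ 1+\tfrac1\alpha\right\}\cdot\left(1-\tfrac1m\right)\right)\text{-competitive}$$ on all instances in which the testing times of all jobs are uniform (equal to each other).
   Context: Problem. There are $n$ jobs, all available at time $0$, and $m$ identical machines, each of which runs one task at a time. Job $j$ has a testing time $t_j> 0$, an upper limit $u_j\ge 0$, and a real processing time $p_j\in[0,u_j]$. A job may be executed untested, which takes $u_j$ time units, or it may be tested (taking $t_j$ time units) and afterwards, once the test is finished, executed in $p_j$ time units; other tasks may run between the test and the execution, and the test and the execution of a job may be on different machines. The completion time of a job is the time at which its execution (or execution-untested) ends, and the cost of a schedule is the sum of the completion times of all jobs. An online algorithm knows all $t_j,u_j$ from the start, but learns $p_j$ only when the test of $j$ is finished. $\mathrm{OPT}$ knows all $p_j$ in advance (but must still test $j$ in order to run it in time $p_j$), and its cost is the minimum cost of any schedule; it spends $\min\{u_j,t_j+p_j\}$ on job $j$ and runs jobs in non-decreasing order of this quantity whenever a machine is available. An algorithm $A$ is $c$-competitive on a class of instances if $\mathrm{cost}(A)\le c\cdot\mathrm{cost}(\mathrm{OPT})$ on all instances of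 the class. *)

theory Defs
  imports Complex_Main
begin

text \<open>The jobs of an instance are \<open>{..<njobs I}\<close>; values of the fields outside that range are
  irrelevant.\<close>

record testing_instance =
  njobs :: nat
  test_time :: "nat \<Rightarrow> real"
  upper_limit :: "nat \<Rightarrow> real"
  proc_time :: "nat \<Rightarrow> real"

definition valid_instance :: "testing_instance \<Rightarrow> bool" where
  "valid_instance I \<longleftrightarrow>
     (\<forall>j<njobs I. 0 < test_time I j \<and> 0 \<le> upper_limit I j \<and>
        0 \<le> proc_time I j \<and> proc_time I j \<le> upper_limit I j)"

definition uniform_tests :: "testing_instance set" where
  "uniform_tests = {I. \<forall>j<njobs I. \<forall>j'<njobs I. test_time I j = test_time I j'}"

text \<open>\<open>Untested i s\<close>: run the job untested on machine \<open>i\<close> from time \<open>s\<close> on.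
  \<open>Tested i s i' s'\<close>: test it on machine \<open>i\<close> from time \<open>s\<close> on and execute it on machine \<open>i'\<close> from
  time \<open>s'\<close> on.\<close>

datatype job_plan = Untested nat real | Tested nat real nat real

type_synonym schedule = "nat \<Rightarrow> job_plan"

datatype task_kind = Run_Untested | Test | Run_Tested

fun tasks :: "job_plan \<Rightarrow> (task_kind \<times> nat \<times> real) set" where
  "tasks (Untested i s) = {(Run_Untested, i, s)}"
| "tasks (Tested i s i' s') = {(Test, i, s), (Run_Tested, i', s')}"

fun duration :: "testing_instance \<Rightarrow> nat \<Rightarrow> task_kind \<Rightarrow> real" where
  "duration I j Run_Untested = upper_limit I j"
| "duration I j Test = test_time I j"
| "duration I j Run_Tested = proc_time I j"

text \<open>In the third clause a task of length \<open>0\<close> must not lie strictly inside another task on the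
  same machine, but may touch its endpoints.\<close>

definition feasible :: "nat \<Rightarrow> testing_instance \<Rightarrow> schedule \<Rightarrow> bool" where
  "feasible m I S \<longleftrightarrow>
     (\<forall>j<njobs I. \<forall>(k, i, s)\<in>tasks (S j). i < m \<and> 0 \<le> s) \<and>
     (\<forall>j<njobs I. \<forall>i s i' s'. S j = Tested i s i' s' \<longrightarrow> s + test_time I j \<le> s') \<and>
     (\<forall>j<njobs I. \<forall>j'<njobs I. \<forall>(k, i, s)\<in>tasks (S j). \<forall>(k', i', s')\<in>tasks (S j').
        (j, k) \<noteq> (j', k') \<and> i = i' \<longrightarrow>
          s + duration I j k \<le> s' \<or> s' + duration I j' k' \<le> s)"

fun completion_time :: "testing_instance \<Rightarrow> nat \<Rightarrow> job_plan \<Rightarrow> real" where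
  "completion_time I j (Untested i s) = s + upper_limit I j"
| "completion_time I j (Tested i s i' s') = s' + proc_time I j"

definition cost :: "testing_instance \<Rightarrow> schedule \<Rightarrow> real" where
  "cost I S = (\<Sum>j<njobs I. completion_time I j (S j))"

definition opt_cost :: "nat \<Rightarrow> testing_instance \<Rightarrow> real" where
  "opt_cost m I = Inf {cost I S | S. feasible m I S}"

text \<open>A deterministic algorithm is given by the schedule it produces on each instance. It is online
  if it does not anticipate: on two instances that look the same at the start, it has started the
  same tasks up to and including time \<open>\<tau>\<close> whenever the tests finished by time \<open>\<tau>\<close> have revealed the
  same processing times. Testing times being positive, this determines what the algorithm does at
  time \<open>\<tau>\<close> from \<open>n\<close>, \<open>t\<close>, \<open>u\<close> and the results of the tests finished by then.\<close>

definition test_finished :: "testing_instance \<Rightarrow> schedule \<Rightarrow> real \<Rightarrow> nat \<Rightarrow> bool" where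
  "test_finished I S \<tau> j \<longleftrightarrow> (\<exists>i s. (Test, i, s) \<in> tasks (S j) \<and> s + test_time I j \<le> \<tau>)"

definition started :: "schedule \<Rightarrow> real \<Rightarrow> nat \<Rightarrow> (task_kind \<times> nat \<times> real) set" where
  "started S \<tau> j = {(k, i, s) \<in> tasks (S j). s \<le> \<tau>}"

definition same_initial_data :: "testing_instance \<Rightarrow> testing_instance \<Rightarrow> bool" where
  "same_initial_data I I' \<longleftrightarrow>
     njobs I = njobs I' \<and>
     (\<forall>j<njobs I. test_time I j = test_time I' j \<and> upper_limit I j = upper_limit I' j)"

definition non_anticipating :: "(testing_instance \<Rightarrow> schedule) \<Rightarrow> bool" where
  "non_anticipating A \<longleftrightarrow>
     (\<forall>I I' \<tau>. valid_instance I \<and> valid_instance I' \<and> same_initial_data I I' \<and>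
        (\<forall>j<njobs I. test_finished I (A I) \<tau> j \<longrightarrow> proc_time I j = proc_time I' j) \<longrightarrow>
        (\<forall>j<njobs I. started (A I) \<tau> j = started (A I') \<tau> j))"

definition online_algorithm :: "nat \<Rightarrow> (testing_instance \<Rightarrow> schedule) \<Rightarrow> bool" where
  "online_algorithm m A \<longleftrightarrow>
     (\<forall>I. valid_instance I \<longrightarrow> feasible m I (A I)) \<and> non_anticipating A"

definition competitive_on ::
  "testing_instance set \<Rightarrow> nat \<Rightarrow> real \<Rightarrow> (testing_instance \<Rightarrow> schedule) \<Rightarrow> bool" where
  "competitive_on C m c A \<longleftrightarrow>
     (\<forall>I\<in>C. valid_instance I \<longrightarrow> cost I (A I) \<le> c * opt_cost m I)"

text \<open>The infimum in \<open>opt_cost\<close> is over a nonempty set that is bounded below.\<close>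

lemma feasible_exists:
  assumes "valid_instance I" "1 \<le> m"
  shows "\<exists>S. feasible m I S"
proof
  let ?S = "\<lambda>j. Untested 0 (\<Sum>l<j. upper_limit I l)"
  have *: "(\<Sum>l<j. upper_limit I l) + upper_limit I j \<le> (\<Sum>l<j'. upper_limit I l)"
    if "j < j'" "j' < njobs I" for j j'
  proof -
    have "(\<Sum>l<Suc j. upper_limit I l) \<le> (\<Sum>l<j'. upper_limit I l)"
      using that assms(1) by (intro sum_mono2) (auto simp: valid_instance_def)
    then show ?thesis by simp
  qed
  have "0 \<le> (\<Sum>l<j. upper_limit I l)" if "j < njobs I" for j
    using that assms(1) by (intro sum_nonneg) (auto simp: valid_instance_def)
  then show "feasible m I ?S"
    using assms(2) * unfolding feasible_def by (auto simp: neq_iff)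
qed

lemma cost_nonneg:
  assumes "valid_instance I" "feasible m I S"
  shows "0 \<le> cost I S"
  unfolding cost_def
proof (rule sum_nonneg)
  fix j assume "j \<in> {..<njobs I}"
  then show "0 \<le> completion_time I j (S j)"
    using assms by (cases "S j") (fastforce simp: valid_instance_def feasible_def)+
qed

lemma opt_cost_le:
  assumes "valid_instance I" "feasible m I S"
  shows "opt_cost m I \<le> cost I S"
  unfolding opt_cost_def
  using assms by (intro cInf_lower) (auto intro!: bdd_belowI[of _ 0] cost_nonneg)

end

theory Submission
  imports Defs "HOL-Analysis.Convex"
begin

text \<open>The algorithm list-schedules the jobs by non-decreasing upper limit, running \<open>j\<close> untested if
  \<open>u\<^sub>j < \<alpha> t\<close> and only testing it otherwise; once every test has finished, it list-schedules the
  tested jobs by non-decreasing processing time. Write \<open>q\<^sub>j = min u\<^sub>j (t + p\<^sub>j)\<close>. For each pair of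
  jobs the work by which they delay each other is at most \<open>R min q\<^sub>i q\<^sub>j\<close>, and the time spent on \<open>j\<close>
  itself is at most \<open>r q\<^sub>j\<close>. By the list scheduling bound the cost on \<open>m\<close> machines is therefore at
  most \<open>1 / m\<close> times \<open>R\<close> times the optimum on one machine plus \<open>(1 - 1 / m) r \<Sum> q\<^sub>j\<close>; the wait for
  the last test fits into this because tests have equal length.

  The optimum is bounded below by \<open>\<Sum> q\<^sub>j\<close> and by the bound of Eastman, Even and Isaacs. The latter is
  proved through mean busy times, which is insensitive to a job being split between two machines:
  with density \<open>1 / w\<^sub>j\<close> for the tasks of a job of total length \<open>w\<^sub>j\<close>, the mean busy times on one
  machine sum to at least a quadratic form in the task lengths with kernel \<open>min\<close> of the densities,
  and positive semidefiniteness of this kernel compares the sum over the machines with the form for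
  all tasks together.\<close>

section \<open>A lower bound on the cost of every schedule\<close>

text \<open>Layer-cake argument: \<open>min (\<omega> a) (\<omega> b)\<close> is the measure of the
  levels below both weights, so the form is a nonnegative combination of block sums of
  \<open>c\<close> over superlevel sets of \<open>\<omega>\<close>. The induction peels off the
  lowest level \<open>v\<close>, after which the elements of weight \<open>v\<close> drop
  out.\<close>

lemma min_kernel_nonneg:
  fixes \<omega> :: "'a \<Rightarrow> real" and c :: "'a \<Rightarrow> 'a \<Rightarrow> real"
  assumes "finite T" "\<And>a. a \<in> T \<Longrightarrow> 0 \<le> \<omega> a"
    and "\<And>X. X \<subseteq> T \<Longrightarrow> 0 \<le> (\<Sum>a\<in>X. \<Sum>b\<in>X. c a b)"
  shows "0 \<le> (\<Sum>a\<in>T. \<Sum>b\<in>T. c a b * min (\<omega> a) (\<omega> b))"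
  using assms
proof (induction "card T" arbitrary: T \<omega> rule: less_induct)
  case less
  show ?case
  proof (cases "T = {}")
    case False
    define v where "v = Min (\<omega> ` T)"
    have v: "v \<le> \<omega> a" if "a \<in> T" for a
      using that less.prems(1) by (simp add: v_def)
    have "v \<in> \<omega> ` T"
      unfolding v_def using less.prems(1) False by (intro Min_in) auto
    then obtain x where x: "x \<in> T" "\<omega> x = v"
      by auto
    define T' where "T' = {a \<in> T. v < \<omega> a}"
    have T': "T' \<subseteq> T" "finite T'"
      using less.prems(1) by (auto simp: T'_def)
    have "T' \<subset> T"
      using x by (auto simp: T'_def)
    then have "card T' < card T"
      using less.prems(1) by (rule psubset_card_mono[rotated])
    then have IH: "0 \<le> (\<Sum>a\<in>T'. \<Sum>b\<in>T'. c a b * min (\<omega> a - v) (\<omega> b - v))"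
      using less.prems(3) T' by (intro less.hyps) (auto simp: T'_def)
    have "(\<Sum>a\<in>T. \<Sum>b\<in>T. c a b * min (\<omega> a - v) (\<omega> b - v)) =
        (\<Sum>a\<in>T'. \<Sum>b\<in>T. c a b * min (\<omega> a - v) (\<omega> b - v))"
    proof (intro sum.mono_neutral_right ballI sum.neutral)
      fix a b assume "a \<in> T - T'" "b \<in> T"
      then have "\<omega> a = v" "v \<le> \<omega> b"
        using v[of a] v[of b] by (auto simp: T'_def)
      then show "c a b * min (\<omega> a - v) (\<omega> b - v) = 0"
        by simp
    qed (use T' less.prems(1) in auto)
    also have "\<dots> = (\<Sum>a\<in>T'. \<Sum>b\<in>T'. c a b * min (\<omega> a - v) (\<omega> b - v))"
      using v T' less.prems(1)
      by (intro sum.cong sum.mono_neutral_right) (fastforce simp: T'_def min_def not_less)+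
    finally have rest: "0 \<le> (\<Sum>a\<in>T. \<Sum>b\<in>T. c a b * min (\<omega> a - v) (\<omega> b - v))"
      using IH by simp
    have "(\<Sum>a\<in>T. \<Sum>b\<in>T. c a b * min (\<omega> a) (\<omega> b)) =
        (\<Sum>a\<in>T. \<Sum>b\<in>T. v * c a b + c a b * min (\<omega> a - v) (\<omega> b - v))"
      by (intro sum.cong refl) (auto simp: min_def algebra_simps)
    also have "\<dots> = v * (\<Sum>a\<in>T. \<Sum>b\<in>T. c a b) +
        (\<Sum>a\<in>T. \<Sum>b\<in>T. c a b * min (\<omega> a - v) (\<omega> b - v))"
      by (simp add: sum.distrib sum_distrib_left)
    moreover have "0 \<le> v" "0 \<le> (\<Sum>a\<in>T. \<Sum>b\<in>T. c a b)"
      using less.prems x by auto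
    ultimately show ?thesis
      using rest by simp
  qed simp
qed

text \<open>By \<open>min_kernel_nonneg\<close> the weights can be ignored and only block sums
  matter; there the claim is Cauchy-Schwarz over the \<open>m\<close> machines.\<close>

lemma same_machine_kernel:
  fixes l :: "'a \<Rightarrow> real" and \<omega> :: "'a \<Rightarrow> real" and \<mu> :: "'a \<Rightarrow> nat"
  assumes "finite T" "\<And>a. a \<in> T \<Longrightarrow> 0 \<le> \<omega> a" "\<And>a. a \<in> T \<Longrightarrow> \<mu> a < m"
  shows "(\<Sum>a\<in>T. \<Sum>b\<in>T. l a * l b * min (\<omega> a) (\<omega> b)) \<le>
    real m * (\<Sum>a\<in>T. \<Sum>b\<in>T. (if \<mu> a = \<mu> b then l a * l b * min (\<omega> a) (\<omega> b) else 0))"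
proof -
  define c where "c a b = real m * (if \<mu> a = \<mu> b then l a * l b else 0) - l a * l b" for a b
  have "0 \<le> (\<Sum>a\<in>X. \<Sum>b\<in>X. c a b)" if "X \<subseteq> T" for X
  proof -
    have X: "finite X" "\<mu> ` X \<subseteq> {..<m}"
      using that assms finite_subset by auto
    \<comment> \<open>\<open>g i\<close> is the total length of the tasks of \<open>X\<close> on
      machine \<open>i\<close>.\<close>
    define g where "g i = (\<Sum>a | a \<in> X \<and> \<mu> a = i. l a)" for i
    have g: "(\<Sum>a\<in>X. f a * l a) = (\<Sum>i<m. \<Sum>a | a \<in> X \<and> \<mu> a = i. f a * l a)" for f
      using sum.group[of X "{..<m}" \<mu> "\<lambda>a. f a * l a"] X by simp
    have "(\<Sum>a\<in>X. \<Sum>b\<in>X. if \<mu> a = \<mu> b then l a * l b else 0) = (\<Sum>a\<in>X. g (\<mu> a) * l a)"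
      using X by (intro sum.cong refl)
        (simp add: g_def sum_distrib_left sum.inter_filter[symmetric] eq_commute mult.commute)
    also have "\<dots> = (\<Sum>i<m. (g i)\<^sup>2)"
      unfolding g by (simp add: g_def power2_eq_square sum_distrib_left)
    finally have same: "(\<Sum>a\<in>X. \<Sum>b\<in>X. if \<mu> a = \<mu> b then l a * l b else 0) = (\<Sum>i<m. (g i)\<^sup>2)" .
    have "(\<Sum>a\<in>X. \<Sum>b\<in>X. l a * l b) = (\<Sum>a\<in>X. 1 * l a)\<^sup>2"
      by (simp add: power2_eq_square sum_product)
    also have "\<dots> = (\<Sum>i<m. g i)\<^sup>2"
      unfolding g by (simp add: g_def)
    also have "\<dots> \<le> real m * (\<Sum>i<m. (g i)\<^sup>2)"
      using sum_squared_le_sum_of_squares[of g "{..<m}"] by (simp add: mult.commute)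
    finally show ?thesis
      using same by (simp add: c_def sum_subtractf sum_distrib_left[symmetric])
  qed
  then have "0 \<le> (\<Sum>a\<in>T. \<Sum>b\<in>T. c a b * min (\<omega> a) (\<omega> b))"
    using assms by (intro min_kernel_nonneg) auto
  also have "\<dots> = (\<Sum>a\<in>T. \<Sum>b\<in>T. real m *
      (if \<mu> a = \<mu> b then l a * l b * min (\<omega> a) (\<omega> b) else 0) - l a * l b * min (\<omega> a) (\<omega> b))"
    by (intro sum.cong refl) (auto simp: c_def algebra_simps)
  finally show ?thesis
    by (simp add: sum_subtractf sum_distrib_left)
qed

section \<open>Disjoint intervals and midpoints on one machine\<close>

text \<open>Induction by increasing start: the interval \<open>x\<close> added last starts latest,
  so the others end by \<open>s x\<close>, which becomes their horizon.\<close>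

lemma sum_lengths_le_horizon:
  fixes s l :: "'a \<Rightarrow> real"
  assumes "finite X"
    and "\<And>a. a \<in> X \<Longrightarrow> 0 \<le> s a \<and> 0 \<le> l a \<and> s a + l a \<le> e"
    and "\<And>a b. a \<in> X \<Longrightarrow> b \<in> X \<Longrightarrow> a \<noteq> b \<Longrightarrow> s a + l a \<le> s b \<or> s b + l b \<le> s a"
    and "0 \<le> e"
  shows "(\<Sum>a\<in>X. l a) \<le> e"
  using assms
proof (induction X arbitrary: e rule: finite_ranking_induct[where f = s])
  case (insert x X)
  show ?case
  \<comment> \<open>The induction rule does not guarantee that \<open>x\<close> is new. An interval
    of length 0 may share its start with a longer one that ends later, but it adds nothing to the
    sum.\<close>
  proof (cases "x \<in> X \<or> l x = 0")
    case True
    have "(\<Sum>a\<in>X. l a) \<le> e"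
      using insert.prems by (intro insert.IH) auto
    then show ?thesis
      using True insert.hyps by (auto simp: sum.insert_if)
  next
    case False
    have "s a + l a \<le> s x" if "a \<in> X" for a
    proof -
      have "s a \<le> s x" "0 < l x" "x \<noteq> a"
        using that insert.hyps insert.prems(1)[of x] False by force+
      then show ?thesis
        using insert.prems(2)[of x a] that by auto
    qed
    then have "(\<Sum>a\<in>X. l a) \<le> s x"
      using insert.prems by (intro insert.IH) auto
    then show ?thesis
      using insert.prems(1)[of x] insert.hyps by (simp add: sum.insert_if)
  qed
qed simp

text \<open>Every unordered pair on a common machine is counted at least once on the right with the
  density of its later task, which is at least the minimum of the two.\<close>

lemma weighted_midpoints:
  fixes s l \<omega> :: "'a \<Rightarrow> real" and \<mu> :: "'a \<Rightarrow> nat"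
  assumes "finite T"
    and nn: "\<And>a. a \<in> T \<Longrightarrow> 0 \<le> s a \<and> 0 \<le> l a \<and> 0 \<le> \<omega> a"
    and disj: "\<And>a b. a \<in> T \<Longrightarrow> b \<in> T \<Longrightarrow> a \<noteq> b \<Longrightarrow> \<mu> a = \<mu> b \<Longrightarrow>
      s a + l a \<le> s b \<or> s b + l b \<le> s a"
  shows "(\<Sum>a\<in>T. \<Sum>b\<in>T. (if \<mu> a = \<mu> b then l a * l b * min (\<omega> a) (\<omega> b) else 0)) \<le>
    2 * (\<Sum>a\<in>T. \<omega> a * l a * (s a + l a / 2))"
proof -
  \<comment> \<open>\<open>k a b\<close> is the work of \<open>b\<close> done before
    \<open>a\<close> starts, weighted by \<open>a\<close>; \<open>h\<close> is half of the diagonal,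
    because each entry is added to its transpose below.\<close>
  define k where "k a b = (if a \<noteq> b \<and> \<mu> a = \<mu> b \<and> s b + l b \<le> s a then \<omega> a * l a * l b else 0)"
    for a b
  define h where "h a b = (if a = b then \<omega> a * l a * l a / 2 else 0)" for a b
  \<comment> \<open>In row \<open>a\<close>, the tasks that end by \<open>s a\<close> have total
    length at most \<open>s a\<close>, and \<open>h\<close> supplies the half length up to the
    midpoint.\<close>
  have k: "(\<Sum>b\<in>T. k a b + h a b) \<le> \<omega> a * l a * (s a + l a / 2)" if a: "a \<in> T" for a
  proof -
    define X where "X = {b \<in> T. a \<noteq> b \<and> \<mu> a = \<mu> b \<and> s b + l b \<le> s a}"
    have "(\<Sum>b\<in>X. l b) \<le> s a"
      using assms(1) nn disj a
      by (intro sum_lengths_le_horizon[where s = s and l = l and e = "s a"]) (auto simp: X_def)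
    moreover have "0 \<le> \<omega> a * l a"
      using nn a by simp
    ultimately have "\<omega> a * l a * (\<Sum>b\<in>X. l b) \<le> \<omega> a * l a * s a"
      by (rule mult_left_mono)
    moreover have "(\<Sum>b\<in>T. k a b) = \<omega> a * l a * (\<Sum>b\<in>X. l b)"
      unfolding k_def X_def sum_distrib_left using assms(1) by (rule sum.inter_filter[symmetric])
    moreover have "(\<Sum>b\<in>T. h a b) = \<omega> a * l a * (l a / 2)"
      using assms(1) a by (simp add: h_def)
    ultimately show ?thesis
      by (simp add: sum.distrib algebra_simps)
  qed
  have pair: "(if \<mu> a = \<mu> b then l a * l b * min (\<omega> a) (\<omega> b) else 0) \<le>
      (k a b + h a b) + (k b a + h b a)" if "a \<in> T" "b \<in> T" for a b
  proof -
    have "0 \<le> l a * l b"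
      using nn that by simp
    then have "l a * l b * min (\<omega> a) (\<omega> b) \<le> l a * l b * \<omega> a"
      "l a * l b * min (\<omega> a) (\<omega> b) \<le> l a * l b * \<omega> b"
      by (auto intro: mult_left_mono)
    moreover have "0 \<le> l a * l b * \<omega> a" "0 \<le> l a * l b * \<omega> b"
      using nn that by simp_all
    ultimately show ?thesis
      using disj[of a b] that by (auto simp: k_def h_def algebra_simps)
  qed
  have "(\<Sum>a\<in>T. \<Sum>b\<in>T. (if \<mu> a = \<mu> b then l a * l b * min (\<omega> a) (\<omega> b) else 0)) \<le>
      (\<Sum>a\<in>T. \<Sum>b\<in>T. (k a b + h a b) + (k b a + h b a))"
    by (intro sum_mono pair)
  also have "\<dots> = (\<Sum>a\<in>T. \<Sum>b\<in>T. k a b + h a b) + (\<Sum>a\<in>T. \<Sum>b\<in>T. k b a + h b a)"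
    by (simp add: sum.distrib)
  also have "\<dots> = 2 * (\<Sum>a\<in>T. \<Sum>b\<in>T. k a b + h a b)"
    by (subst (2) sum.swap) simp
  also have "\<dots> \<le> 2 * (\<Sum>a\<in>T. \<omega> a * l a * (s a + l a / 2))"
    using k by (intro mult_left_mono sum_mono) auto
  finally show ?thesis .
qed

section \<open>From tasks to jobs: the lower bound for schedules\<close>

definition opt_length :: "testing_instance \<Rightarrow> nat \<Rightarrow> real" where
  "opt_length I j = min (upper_limit I j) (test_time I j + proc_time I j)"

definition plan_length :: "testing_instance \<Rightarrow> schedule \<Rightarrow> nat \<Rightarrow> real" where
  "plan_length I S j = (\<Sum>(k, i, s)\<in>tasks (S j). duration I j k)"

lemma finite_tasks: "finite (tasks P)"
  by (cases P) auto

lemma feasibleD_disjoint: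
  assumes "feasible m I S" "j < njobs I" "j' < njobs I"
    and "(k, i, s) \<in> tasks (S j)" "(k', i, s') \<in> tasks (S j')" "(j, k) \<noteq> (j', k')"
  shows "s + duration I j k \<le> s' \<or> s' + duration I j' k' \<le> s"
proof -
  have "\<forall>(k, i, s)\<in>tasks (S j). \<forall>(k', i', s')\<in>tasks (S j').
      (j, k) \<noteq> (j', k') \<and> i = i' \<longrightarrow> s + duration I j k \<le> s' \<or> s' + duration I j' k' \<le> s"
    using assms(1)[unfolded feasible_def, THEN conjunct2, THEN conjunct2] assms(2,3) by simp
  from bspec[OF bspec[OF this assms(4), unfolded prod.case] assms(5)] assms(6) show ?thesis
    by simp
qed

lemma opt_length_le_plan_length: "opt_length I j \<le> plan_length I S j"
  by (cases "S j") (auto simp: opt_length_def plan_length_def)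

text \<open>The density \<open>1 / plan_length I S j\<close> makes the weights of the tasks of a job sum to \<open>1\<close>; a
  job of length \<open>0\<close> gets density \<open>0\<close>, and its completion time is only used to be nonnegative.
  The right-hand side is the mean busy time of the job plus half its length.\<close>

lemma mean_busy_time_le_completion_time:
  assumes "valid_instance I" "feasible m I S" "j < njobs I"
  shows "(\<Sum>(k, i, s)\<in>tasks (S j).
      1 / plan_length I S j * duration I j k * (s + duration I j k / 2)) + plan_length I S j / 2
    \<le> completion_time I j (S j)"
proof (cases "S j")
  case (Untested i s)
  then have "0 \<le> s"
    using assms by (fastforce simp: feasible_def)
  then show ?thesis
    using Untested by (simp add: plan_length_def)
next
  case (Tested i s i' s')
  let ?t = "test_time I j" and ?p = "proc_time I j"
  have len: "plan_length I S j = ?t + ?p"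
    using Tested by (simp add: plan_length_def)
  have tp: "0 < ?t" "0 \<le> ?p"
    using assms by (auto simp: valid_instance_def)
  have "s + ?t \<le> s'"
    using assms Tested by (auto simp: feasible_def)
  \<comment> \<open>The next inequality is an equality when the execution follows the test at once;
    a gap only makes the mean busy time earlier.\<close>
  then have "?t * (s + ?t) \<le> ?t * s'"
    using tp by simp
  then have "?t * (s + ?t / 2) + ?p * (s' + ?p / 2) \<le> (s' + ?p - (?t + ?p) / 2) * (?t + ?p)"
    by (simp add: field_simps)
  then have "(?t * (s + ?t / 2) + ?p * (s' + ?p / 2)) / (?t + ?p) \<le> s' + ?p - (?t + ?p) / 2"
    using tp by (simp add: pos_divide_le_eq)
  then show ?thesis
    unfolding len using Tested by (simp add: add_divide_distrib)
qed

text \<open>With \<open>M\<close> the double sum and \<open>Q\<close> the single sum,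
  \<open>(M + Q) / 2\<close> is the one-machine optimum for the lengths \<open>opt_length\<close>.
  Divided by \<open>2 * m\<close>, this is the bound of Eastman, Even and Isaacs: that optimum over
  \<open>m\<close>, plus \<open>(m - 1) / (2 * m)\<close> times \<open>Q\<close>.\<close>

lemma cost_ge_pairwise_minima:
  assumes "valid_instance I" "feasible m I S"
  shows "(\<Sum>i<njobs I. \<Sum>j<njobs I. min (opt_length I i) (opt_length I j))
      + real m * (\<Sum>j<njobs I. opt_length I j) \<le> 2 * real m * cost I S"
proof -
  let ?n = "njobs I" and ?w = "plan_length I S"
  define T where "T = Sigma {..<?n} (\<lambda>j. tasks (S j))"
  define l where "l = (\<lambda>(j, k, i :: nat, s :: real). duration I j k)"
  define st where "st = (\<lambda>(j :: nat, k :: task_kind, i :: nat, s :: real). s)"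
  define \<mu> where "\<mu> = (\<lambda>(j :: nat, k :: task_kind, i :: nat, s :: real). i)"
  define \<omega> where "\<omega> = (\<lambda>(j, k :: task_kind, i :: nat, s :: real). 1 / ?w j)"
  have fin: "finite T"
    by (simp add: T_def finite_tasks)
  have sumT: "(\<Sum>a\<in>T. f a) = (\<Sum>j<?n. \<Sum>x\<in>tasks (S j). f (j, x))" for f :: "_ \<Rightarrow> real"
    unfolding T_def by (subst sum.Sigma) (auto simp: finite_tasks)
  have dur: "0 \<le> duration I j k" if "j < ?n" for j k
    using assms(1) that by (cases k) (auto simp: valid_instance_def less_imp_le)
  have w: "0 \<le> ?w j" if "j < ?n" for j
    unfolding plan_length_def using dur that by (intro sum_nonneg) auto
  have nn: "0 \<le> st a \<and> 0 \<le> l a \<and> 0 \<le> \<omega> a" "\<mu> a < m" if "a \<in> T" for a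
    using that assms(2) dur w by (fastforce simp: T_def st_def l_def \<omega>_def \<mu>_def feasible_def)+
  \<comment> \<open>\<open>feasible\<close> separates tasks with different pairs of job and kind, so
    the kind must identify a task within its plan.\<close>
  have kinds: "x = y" if "x \<in> tasks P" "y \<in> tasks P" "fst x = fst y" for x y P
    using that by (cases P) auto
  have disj: "st a + l a \<le> st b \<or> st b + l b \<le> st a"
    if ab: "a \<in> T" "b \<in> T" "a \<noteq> b" "\<mu> a = \<mu> b" for a b
  proof -
    obtain j k i s where a: "a = (j, k, i, s)"
      by (cases a) auto
    obtain j' k' i' s' where b: "b = (j', k', i', s')"
      by (cases b) auto
    have "(j, k) \<noteq> (j', k')"
      using ab kinds[of "(k, i, s)" "S j" "(k', i', s')"] by (auto simp: a b T_def)
    then show ?thesis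
      using feasibleD_disjoint[OF assms(2), of j j' k i s k' s'] ab
      by (simp add: a b T_def l_def st_def \<mu>_def)
  qed
  have \<omega>: "\<omega> (j, x) = 1 / ?w j" for j x
    by (simp add: \<omega>_def case_prod_unfold)
  have lw: "(\<Sum>x\<in>tasks (S j). l (j, x)) = ?w j" for j
    by (simp add: l_def plan_length_def case_prod_unfold)
  \<comment> \<open>The density depends only on the job, so the task lengths of each job add up to
    \<open>?w j\<close> and the way a job is split disappears.\<close>
  have "(\<Sum>a\<in>T. \<Sum>b\<in>T. l a * l b * min (\<omega> a) (\<omega> b)) =
      (\<Sum>a\<in>T. \<Sum>j'<?n. l a * ?w j' * min (\<omega> a) (1 / ?w j'))"
    unfolding sumT[of "\<lambda>b. l _ * l b * min (\<omega> _) (\<omega> b)"]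
    by (simp add: \<omega> lw flip: sum_distrib_left sum_distrib_right)
  also have "\<dots> = (\<Sum>j'<?n. \<Sum>a\<in>T. l a * ?w j' * min (\<omega> a) (1 / ?w j'))"
    by (rule sum.swap)
  also have "\<dots> = (\<Sum>j'<?n. \<Sum>j<?n. ?w j * ?w j' * min (1 / ?w j) (1 / ?w j'))"
    unfolding sumT by (simp add: \<omega> lw flip: sum_distrib_right)
  also have "\<dots> = (\<Sum>j<?n. \<Sum>j'<?n. ?w j * ?w j' * min (1 / ?w j) (1 / ?w j'))"
    by (rule sum.swap)
  also have "\<dots> = (\<Sum>j<?n. \<Sum>j'<?n. min (?w j) (?w j'))"
  proof (intro sum.cong refl)
    fix j j' assume "j \<in> {..<?n}" "j' \<in> {..<?n}"
    then have "0 \<le> ?w j" "0 \<le> ?w j'"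
      using w by auto
    then show "?w j * ?w j' * min (1 / ?w j) (1 / ?w j') = min (?w j) (?w j')"
      by (cases "?w j = 0 \<or> ?w j' = 0") (auto simp: min_def field_simps)
  qed
  finally have pairs: "(\<Sum>a\<in>T. \<Sum>b\<in>T. l a * l b * min (\<omega> a) (\<omega> b)) =
    (\<Sum>j<?n. \<Sum>j'<?n. min (?w j) (?w j'))" .
  have "(\<Sum>a\<in>T. \<omega> a * l a * (st a + l a / 2)) + (\<Sum>j<?n. ?w j / 2) \<le> cost I S"
    unfolding sumT cost_def sum.distrib[symmetric]
    using mean_busy_time_le_completion_time[OF assms]
    by (intro sum_mono) (auto simp: \<omega>_def l_def st_def case_prod_unfold)
  then have "2 * real m * ((\<Sum>a\<in>T. \<omega> a * l a * (st a + l a / 2)) + (\<Sum>j<?n. ?w j / 2))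
      \<le> 2 * real m * cost I S"
    by (rule mult_left_mono) simp
  moreover have "(\<Sum>a\<in>T. \<Sum>b\<in>T. (if \<mu> a = \<mu> b then l a * l b * min (\<omega> a) (\<omega> b) else 0)) \<le>
      2 * (\<Sum>a\<in>T. \<omega> a * l a * (st a + l a / 2))"
    using fin nn disj by (intro weighted_midpoints)
  then have "(\<Sum>j<?n. \<Sum>j'<?n. min (?w j) (?w j')) \<le>
      real m * (2 * (\<Sum>a\<in>T. \<omega> a * l a * (st a + l a / 2)))"
    unfolding pairs[symmetric]
    using fin nn by (intro order_trans[OF same_machine_kernel mult_left_mono]) auto
  \<comment> \<open>Only now are the lengths used by \<open>S\<close> replaced by the optimal ones;
    both sums are monotone in the lengths.\<close>
  moreover have "(\<Sum>j<?n. \<Sum>j'<?n. min (opt_length I j) (opt_length I j')) \<le>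
      (\<Sum>j<?n. \<Sum>j'<?n. min (?w j) (?w j'))"
    by (intro sum_mono min.mono opt_length_le_plan_length)
  moreover have "real m * (\<Sum>j<?n. opt_length I j) \<le> real m * (\<Sum>j<?n. ?w j)"
    by (intro mult_left_mono sum_mono opt_length_le_plan_length) auto
  ultimately show ?thesis
    by (simp add: algebra_simps sum_divide_distrib[symmetric])
qed

text \<open>This crude bound absorbs the multiple of the sum of the \<open>opt_length\<close> values
  left over once \<open>cost_ge_pairwise_minima\<close> has been applied \<open>R\<close>
  times.\<close>

lemma cost_ge_sum_opt_length:
  assumes "valid_instance I" "feasible m I S"
  shows "(\<Sum>j<njobs I. opt_length I j) \<le> cost I S"
  unfolding cost_def
proof (rule sum_mono)
  fix j assume "j \<in> {..<njobs I}"
  then show "opt_length I j \<le> completion_time I j (S j)"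
    using assms by (cases "S j") (fastforce simp: opt_length_def feasible_def)+
qed

section \<open>List scheduling\<close>

definition least_loaded :: "nat \<Rightarrow> (nat \<Rightarrow> real) \<Rightarrow> nat" where
  "least_loaded m L = arg_min_on L {..<m}"

text \<open>\<open>L i\<close> is the time at which machine \<open>i\<close> becomes free; a nonzero
  initial \<open>L\<close> lets the second phase follow the first. The result is a machine and a
  start time, with default \<open>(0, 0)\<close> for jobs outside the list.\<close>

primrec list_schedule ::
  "nat \<Rightarrow> (nat \<Rightarrow> real) \<Rightarrow> (nat \<Rightarrow> real) \<Rightarrow> nat list \<Rightarrow> nat \<Rightarrow> nat \<times> real" where
  "list_schedule m d L [] = (\<lambda>j. (0, 0))"
| "list_schedule m d L (x # xs) = (let i = least_loaded m L in
     (list_schedule m d (L(i := L i + d x)) xs)(x := (i, L i)))"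

primrec final_load ::
  "nat \<Rightarrow> (nat \<Rightarrow> real) \<Rightarrow> (nat \<Rightarrow> real) \<Rightarrow> nat list \<Rightarrow> nat \<Rightarrow> real" where
  "final_load m d L [] = L"
| "final_load m d L (x # xs) = (let i = least_loaded m L in
     final_load m d (L(i := L i + d x)) xs)"

lemma least_loaded:
  assumes "1 \<le> m"
  shows "least_loaded m L < m" and "i < m \<Longrightarrow> L (least_loaded m L) \<le> L i"
proof -
  have "{..<m} \<noteq> {}"
    using assms by (simp add: lessThan_empty_iff)
  then show "least_loaded m L < m" and "i < m \<Longrightarrow> L (least_loaded m L) \<le> L i"
    using arg_min_if_finite(1)[of "{..<m}" L] arg_min_least[of "{..<m}" i L]
    by (auto simp: least_loaded_def)
qed

lemma list_schedule_cong:
  assumes "\<forall>x\<in>set xs. d x = d' x"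
  shows "list_schedule m d L xs = list_schedule m d' L xs"
    and "final_load m d L xs = final_load m d' L xs"
  using assms by (induction xs arbitrary: L) (simp_all add: Let_def)

lemma final_load_ge:
  assumes "\<forall>x\<in>set xs. 0 \<le> d x"
  shows "L i \<le> final_load m d L xs i"
  using assms
proof (induction xs arbitrary: L)
  case (Cons x xs)
  let ?i = "least_loaded m L"
  have "L i \<le> (L(?i := L ?i + d x)) i"
    using Cons.prems by simp
  also have "\<dots> \<le> final_load m d (L(?i := L ?i + d x)) xs i"
    using Cons.prems by (intro Cons.IH) simp
  finally show ?case
    by (simp add: Let_def)
qed simp

lemma sum_final_load:
  assumes "1 \<le> m" "distinct xs"
  shows "(\<Sum>i<m. final_load m d L xs i) = (\<Sum>i<m. L i) + (\<Sum>x\<in>set xs. d x)"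
  using assms(2)
proof (induction xs arbitrary: L)
  case (Cons x xs)
  let ?i = "least_loaded m L"
  have "(\<Sum>i<m. (L(?i := L ?i + d x)) i) = (\<Sum>i<m. L i + (if i = ?i then d x else 0))"
    by (intro sum.cong) auto
  also have "\<dots> = (\<Sum>i<m. L i) + d x"
    using least_loaded(1)[OF assms(1), of L] by (simp add: sum.distrib)
  finally show ?case
    using Cons by (simp add: Let_def)
qed simp

text \<open>When \<open>j\<close> is placed, \<open>s\<close> is the least load, and loads only
  grow. Hence the last conjunct: every machine is busy up to \<open>s\<close>, which later limits
  the wait for the last test.\<close>

lemma list_schedule_bounds:
  assumes "1 \<le> m" "distinct xs" "\<forall>x\<in>set xs. 0 \<le> d x" "j \<in> set xs"
    and "list_schedule m d L xs j = (i, s)"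
  shows "i < m \<and> L i \<le> s \<and> s + d j \<le> final_load m d L xs i \<and>
    (\<forall>i'<m. s \<le> final_load m d L xs i')"
  using assms(2-5)
proof (induction xs arbitrary: L)
  case (Cons x xs)
  let ?i = "least_loaded m L"
  let ?L = "L(?i := L ?i + d x)"
  have ge: "L i' \<le> ?L i'" "?L i' \<le> final_load m d ?L xs i'" for i'
    using Cons.prems(2) final_load_ge[of xs d ?L] by auto
  show ?case
  proof (cases "j = x")
    case True
    then have start: "i = ?i" "s = L ?i"
      using Cons.prems(4) by (auto simp: Let_def)
    have "s \<le> final_load m d ?L xs i'" if "i' < m" for i'
      unfolding start using least_loaded(2)[OF assms(1) that, of L] ge[of i'] by linarith
    then show ?thesis
      using least_loaded(1)[OF assms(1), of L] ge(2)[of ?i] True by (simp add: start Let_def)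
  next
    case False
    then have "i < m \<and> ?L i \<le> s \<and> s + d j \<le> final_load m d ?L xs i \<and>
        (\<forall>i'<m. s \<le> final_load m d ?L xs i')"
      using Cons.prems by (intro Cons.IH) (auto simp: Let_def fun_upd_def)
    moreover have "L i \<le> ?L i"
      by (rule ge)
    ultimately show ?thesis
      unfolding final_load.simps Let_def by (meson order_trans)
  qed
qed simp

lemma list_schedule_disjoint:
  assumes "1 \<le> m" "distinct xs" "\<forall>x\<in>set xs. 0 \<le> d x"
    and "j \<in> set xs" "j' \<in> set xs" "j \<noteq> j'"
    and "list_schedule m d L xs j = (i, s)" "list_schedule m d L xs j' = (i, s')"
  shows "s + d j \<le> s' \<or> s' + d j' \<le> s"
  using assms(2-8)
proof (induction xs arbitrary: L)
  case (Cons x xs)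
  let ?i = "least_loaded m L"
  let ?L = "L(?i := L ?i + d x)"
  consider "j = x" "j' \<noteq> x" | "j' = x" "j \<noteq> x" | "j \<noteq> x" "j' \<noteq> x"
    using Cons.prems by blast
  then show ?case
  proof cases
    case 1
    then show ?thesis
      using Cons.prems list_schedule_bounds[OF assms(1), of xs d j' ?L i s']
      by (auto simp: Let_def)
  next
    case 2
    then show ?thesis
      using Cons.prems list_schedule_bounds[OF assms(1), of xs d j ?L i s]
      by (auto simp: Let_def)
  next
    case 3
    then show ?thesis
      using Cons.prems by (intro Cons.IH[of ?L]) (auto simp: Let_def fun_upd_def)
  qed
qed simp

text \<open>The least load is at most the average load, and the total load when \<open>j\<close> is
  placed is the initial one plus the work of its predecessors in the list, all of which satisfy
  \<open>P x j\<close>.\<close>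

lemma list_schedule_start_le:
  assumes "1 \<le> m" "distinct xs" "sorted_wrt P xs" "\<forall>x\<in>set xs. 0 \<le> d x" "j \<in> set xs"
    and "list_schedule m d L xs j = (i, s)"
  shows "real m * s \<le> (\<Sum>i<m. L i) + (\<Sum>x | x \<in> set xs \<and> P x j. d x)"
  using assms(2-6)
proof (induction xs arbitrary: L)
  case (Cons x xs)
  let ?i = "least_loaded m L"
  let ?L = "L(?i := L ?i + d x)"
  show ?case
  proof (cases "j = x")
    case True
    then have "s = L ?i"
      using Cons.prems by (auto simp: Let_def)
    then have "real m * s = (\<Sum>i<m. L ?i)"
      by simp
    also have "\<dots> \<le> (\<Sum>i<m. L i)"
      using least_loaded(2)[OF assms(1)] by (intro sum_mono) auto
    finally have "real m * s \<le> (\<Sum>i<m. L i)" .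
    moreover have "0 \<le> (\<Sum>y | y \<in> set (x # xs) \<and> P y j. d y)"
      using Cons.prems(3) by (intro sum_nonneg) auto
    ultimately show ?thesis
      by linarith
  next
    case False
    then have j: "j \<in> set xs"
      using Cons.prems by simp
    have "{y. y \<in> set (x # xs) \<and> P y j} = insert x {y. y \<in> set xs \<and> P y j}"
      using Cons.prems j by auto
    then have sum: "(\<Sum>y | y \<in> set (x # xs) \<and> P y j. d y) =
        d x + (\<Sum>y | y \<in> set xs \<and> P y j. d y)"
      using Cons.prems by simp
    have "real m * s \<le> (\<Sum>i<m. ?L i) + (\<Sum>y | y \<in> set xs \<and> P y j. d y)"
      using Cons.prems False by (intro Cons.IH) (auto simp: Let_def fun_upd_def)
    moreover have "(\<Sum>i<m. ?L i) = (\<Sum>i<m. L i) + d x"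
      using sum_final_load[OF assms(1), of "[x]" d L] by (simp add: Let_def)
    ultimately show ?thesis
      unfolding sum by linarith
  qed
qed simp

section \<open>Priority orders\<close>

text \<open>Breaking ties by index makes exactly one of two distinct jobs ahead of the other, so
  that ties are not charged twice in the pairwise analysis.\<close>

definition ahead :: "(nat \<Rightarrow> real) \<Rightarrow> nat \<Rightarrow> nat \<Rightarrow> bool" where
  "ahead f i j \<longleftrightarrow> f i < f j \<or> f i = f j \<and> i < j"

definition job_order :: "(nat \<Rightarrow> real) \<Rightarrow> nat \<Rightarrow> nat list" where
  "job_order f n = sort_key f [0..<n]"

lemma job_order: "set (job_order f n) = {..<n}" "distinct (job_order f n)"
  by (auto simp: job_order_def)

text \<open>\<open>sort_key\<close> inserts from the right end of the list, so each inserted index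
  is smaller than all present ones, and \<open>insort_key\<close> puts it before equal keys, as
  \<open>ahead\<close> demands.\<close>

lemma sorted_wrt_job_order: "sorted_wrt (ahead f) (job_order f n)"
proof -
  have insort: "sorted_wrt (ahead f) (insort_key f x xs)"
    if "sorted_wrt (ahead f) xs" "\<forall>y\<in>set xs. x < y" for x xs
    using that by (induction xs) (auto simp: ahead_def set_insort_key)
  have "sorted_wrt (ahead f) (sort_key f xs)" if "sorted_wrt (<) xs" for xs
    using that by (induction xs) (auto intro!: insort)
  then show ?thesis
    by (simp add: job_order_def)
qed

lemma job_order_cong:
  assumes "\<forall>j<n. f j = g j"
  shows "job_order f n = job_order g n"
proof -
  have insort: "insort_key f x xs = insort_key g x xs" if "\<forall>y\<in>insert x (set xs). f y = g y" for x xs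
    using that by (induction xs) auto
  have "sort_key f xs = sort_key g xs" if "\<forall>x\<in>set xs. f x = g x" for xs
    using that by (induction xs) (auto intro!: insort)
  then show ?thesis
    using assms by (simp add: job_order_def)
qed

section \<open>The algorithm\<close>

definition untested :: "real \<Rightarrow> testing_instance \<Rightarrow> nat \<Rightarrow> bool" where
  "untested \<alpha> I j \<longleftrightarrow> upper_limit I j < \<alpha> * test_time I j"

definition first_length :: "real \<Rightarrow> testing_instance \<Rightarrow> nat \<Rightarrow> real" where
  "first_length \<alpha> I j = (if untested \<alpha> I j then upper_limit I j else test_time I j)"

text \<open>Untested jobs take part in the last phase as dummies of length \<open>0\<close>, which do not depend on
  their unknown processing times.\<close>

definition second_length :: "real \<Rightarrow> testing_instance \<Rightarrow> nat \<Rightarrow> real" where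
  "second_length \<alpha> I j = (if untested \<alpha> I j then 0 else proc_time I j)"

definition first_phase :: "nat \<Rightarrow> real \<Rightarrow> testing_instance \<Rightarrow> nat \<Rightarrow> nat \<times> real" where
  "first_phase m \<alpha> I = list_schedule m (first_length \<alpha> I) (\<lambda>_. 0)
     (job_order (upper_limit I) (njobs I))"

text \<open>The inserted 0 is the value when no job is tested.\<close>

definition tests_done :: "nat \<Rightarrow> real \<Rightarrow> testing_instance \<Rightarrow> real" where
  "tests_done m \<alpha> I = Max (insert 0 ((\<lambda>j. snd (first_phase m \<alpha> I j) + test_time I j) `
     {j. j < njobs I \<and> \<not> untested \<alpha> I j}))"

text \<open>Every machine is held until the last test has ended, because the order of the second
  phase depends on all test results.\<close>

definition second_load :: "nat \<Rightarrow> real \<Rightarrow> testing_instance \<Rightarrow> nat \<Rightarrow> real" where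
  "second_load m \<alpha> I i = max (tests_done m \<alpha> I)
     (final_load m (first_length \<alpha> I) (\<lambda>_. 0) (job_order (upper_limit I) (njobs I)) i)"

definition second_phase :: "nat \<Rightarrow> real \<Rightarrow> testing_instance \<Rightarrow> nat \<Rightarrow> nat \<times> real" where
  "second_phase m \<alpha> I = list_schedule m (second_length \<alpha> I) (second_load m \<alpha> I)
     (job_order (second_length \<alpha> I) (njobs I))"

definition test_first :: "nat \<Rightarrow> real \<Rightarrow> testing_instance \<Rightarrow> schedule" where
  "test_first m \<alpha> I j = (case first_phase m \<alpha> I j of (i, s) \<Rightarrow>
     if untested \<alpha> I j then Untested i s
     else case second_phase m \<alpha> I j of (i', s') \<Rightarrow> Tested i s i' s')"

context
  fixes m :: nat and \<alpha> :: real and I :: testing_instance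
  assumes m: "1 \<le> m" and valid: "valid_instance I"
begin

lemma first_length_nonneg: "j < njobs I \<Longrightarrow> 0 \<le> first_length \<alpha> I j"
  using valid by (auto simp: valid_instance_def first_length_def less_imp_le)

lemma second_length_nonneg: "j < njobs I \<Longrightarrow> 0 \<le> second_length \<alpha> I j"
  using valid by (auto simp: valid_instance_def second_length_def)

lemma first_phase_bounds:
  assumes "j < njobs I" "first_phase m \<alpha> I j = (i, s)"
  shows "i < m" "0 \<le> s" "s + first_length \<alpha> I j \<le> second_load m \<alpha> I i"
  using list_schedule_bounds[OF m job_order(2) _ _ assms(2)[unfolded first_phase_def]]
    first_length_nonneg assms(1)
  by (fastforce simp: job_order second_load_def max_def)+

lemma test_end_le_tests_done:
  assumes "j < njobs I" "\<not> untested \<alpha> I j" "first_phase m \<alpha> I j = (i, s)"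
  shows "s + test_time I j \<le> tests_done m \<alpha> I"
  unfolding tests_done_def using assms by (intro Max_ge) force+

lemma second_phase_bounds:
  assumes "j < njobs I" "second_phase m \<alpha> I j = (i, s)"
  shows "i < m" "second_load m \<alpha> I i \<le> s" "tests_done m \<alpha> I \<le> s"
proof -
  show "i < m" and *: "second_load m \<alpha> I i \<le> s"
    using list_schedule_bounds[OF m job_order(2) _ _ assms(2)[unfolded second_phase_def]]
      second_length_nonneg assms(1) by (auto simp: job_order)
  show "tests_done m \<alpha> I \<le> s"
    using * by (simp add: second_load_def)
qed

lemma tests_done_nonneg: "0 \<le> tests_done m \<alpha> I"
  unfolding tests_done_def by (intro Max_ge) auto

lemma test_first_tasks:
  assumes "(k, i, s) \<in> tasks (test_first m \<alpha> I j)"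
  obtains "k \<noteq> Run_Tested" "first_phase m \<alpha> I j = (i, s)" "duration I j k = first_length \<alpha> I j"
    | "k = Run_Tested" "second_phase m \<alpha> I j = (i, s)" "duration I j k = second_length \<alpha> I j"
  using assms
  by (auto simp: test_first_def first_length_def second_length_def split: prod.splits if_splits)

lemma test_first_kind_eq:
  assumes "(k, i, s) \<in> tasks (test_first m \<alpha> I j)" "(k', i', s') \<in> tasks (test_first m \<alpha> I j)"
    and "k \<noteq> Run_Tested" "k' \<noteq> Run_Tested"
  shows "k = k'"
  using assms by (auto simp: test_first_def split: prod.splits if_splits)

lemma feasible_test_first: "feasible m I (test_first m \<alpha> I)"
  unfolding feasible_def
proof (intro conjI)
  show "\<forall>j<njobs I. \<forall>(k, i, s)\<in>tasks (test_first m \<alpha> I j). i < m \<and> 0 \<le> s"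
  proof (intro allI impI ballI, clarify)
    fix j k i s
    assume "j < njobs I" "(k, i, s) \<in> tasks (test_first m \<alpha> I j)"
    then show "i < m \<and> 0 \<le> s"
      using first_phase_bounds(1,2)[of j i s] second_phase_bounds[of j i s] tests_done_nonneg
      by (elim test_first_tasks) auto
  qed
  show "\<forall>j<njobs I. \<forall>i s i' s'. test_first m \<alpha> I j = Tested i s i' s' \<longrightarrow> s + test_time I j \<le> s'"
  proof (intro allI impI)
    fix j i s i' s'
    assume "j < njobs I" "test_first m \<alpha> I j = Tested i s i' s'"
    then show "s + test_time I j \<le> s'"
      using test_end_le_tests_done[of j i s] second_phase_bounds(3)[of j i' s']
      by (auto simp: test_first_def split: prod.splits if_splits)
  qed
  \<comment> \<open>Two tasks of one phase are separated by its list schedule, tasks of different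
    phases by the \<open>second_load\<close> of their machine.\<close>
  have *: "s + duration I j k \<le> s' \<or> s' + duration I j' k' \<le> s"
    if j: "j < njobs I" "j' < njobs I" "(k, i, s) \<in> tasks (test_first m \<alpha> I j)"
      "(k', i, s') \<in> tasks (test_first m \<alpha> I j')" "(j, k) \<noteq> (j', k')" for j j' k k' i s s'
    using j(3)
  proof (cases rule: test_first_tasks)
    case k: 1
    show ?thesis
      using j(4)
    proof (cases rule: test_first_tasks)
      case k': 1
      have "j \<noteq> j'"
        using test_first_kind_eq[of k i s j k' i s'] j k k' by auto
      then show ?thesis
        using list_schedule_disjoint[OF m job_order(2) _ _ _ _ k(2)[unfolded first_phase_def]
            k'(2)[unfolded first_phase_def]] k k' j first_length_nonneg
        by (simp add: job_order)
    next
      case k': 2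
      then show ?thesis
        using first_phase_bounds(3)[OF j(1) k(2)] second_phase_bounds(2)[OF j(2) k'(2)] k by simp
    qed
  next
    case k: 2
    show ?thesis
      using j(4)
    proof (cases rule: test_first_tasks)
      case k': 1
      then show ?thesis
        using first_phase_bounds(3)[OF j(2) k'(2)] second_phase_bounds(2)[OF j(1) k(2)] k by simp
    next
      case k': 2
      then have "j \<noteq> j'"
        using j k by simp
      then show ?thesis
        using list_schedule_disjoint[OF m job_order(2) _ _ _ _ k(2)[unfolded second_phase_def]
            k'(2)[unfolded second_phase_def]] k k' j second_length_nonneg
        by (simp add: job_order)
    qed
  qed
  then show "\<forall>j<njobs I. \<forall>j'<njobs I. \<forall>(k, i, s)\<in>tasks (test_first m \<alpha> I j).
      \<forall>(k', i', s')\<in>tasks (test_first m \<alpha> I j'). (j, k) \<noteq> (j', k') \<and> i = i' \<longrightarrow>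
        s + duration I j k \<le> s' \<or> s' + duration I j' k' \<le> s"
    by (intro allI ballI impI, clarify) blast
qed

end

text \<open>The first phase, \<open>tests_done\<close> and \<open>second_load\<close> depend on the
  initial data only. From \<open>tests_done\<close> on, all processing times that enter the second
  phase are revealed; before it, no task of the second phase has started.\<close>

lemma non_anticipating_test_first:
  assumes m: "1 \<le> m"
  shows "non_anticipating (test_first m \<alpha>)"
  unfolding non_anticipating_def
proof (intro allI impI, elim conjE)
  fix I I' \<tau> j
  assume valid: "valid_instance I" "valid_instance I'" and same: "same_initial_data I I'"
    and seen: "\<forall>j<njobs I. test_finished I (test_first m \<alpha> I) \<tau> j \<longrightarrow> proc_time I j = proc_time I' j"
    and j: "j < njobs I"
  have n: "njobs I' = njobs I"
    and data: "\<forall>j<njobs I. test_time I j = test_time I' j \<and> upper_limit I j = upper_limit I' j"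
    using same by (auto simp: same_initial_data_def)
  have untested: "\<forall>j<njobs I. untested \<alpha> I j = untested \<alpha> I' j"
    using data by (simp add: untested_def)
  have len: "\<forall>j<njobs I. first_length \<alpha> I j = first_length \<alpha> I' j"
    using data untested by (simp add: first_length_def)
  have order: "job_order (upper_limit I) (njobs I) = job_order (upper_limit I') (njobs I)"
    using data by (intro job_order_cong) simp
  have first: "first_phase m \<alpha> I = first_phase m \<alpha> I'"
    unfolding first_phase_def n order using len by (intro list_schedule_cong) (simp add: job_order)
  have finish: "tests_done m \<alpha> I = tests_done m \<alpha> I'"
    unfolding tests_done_def n first using data untested
    by (intro arg_cong[where f = Max] arg_cong[where f = "insert 0"] image_cong) auto
  have load: "second_load m \<alpha> I = second_load m \<alpha> I'"
    unfolding second_load_def finish n order using len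
    by (subst list_schedule_cong(2)[of _ _ "first_length \<alpha> I'"]) (auto simp: job_order)
  show "started (test_first m \<alpha> I) \<tau> j = started (test_first m \<alpha> I') \<tau> j"
  proof (cases "tests_done m \<alpha> I \<le> \<tau>")
    case True
    have "proc_time I i = proc_time I' i" if i: "i < njobs I" "\<not> untested \<alpha> I i" for i
    proof -
      obtain i1 s1 i2 s2 where "first_phase m \<alpha> I i = (i1, s1)" "second_phase m \<alpha> I i = (i2, s2)"
        by fastforce
      then have "test_finished I (test_first m \<alpha> I) \<tau> i"
        using test_end_le_tests_done[OF m valid(1) i] True i
        by (force simp: test_finished_def test_first_def)
      then show ?thesis
        using seen i by simp
    qed
    then have len2: "\<forall>j<njobs I. second_length \<alpha> I j = second_length \<alpha> I' j"
      using untested by (simp add: second_length_def)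
    have second: "second_phase m \<alpha> I = second_phase m \<alpha> I'"
      unfolding second_phase_def n load job_order_cong[OF len2] using len2
      by (intro list_schedule_cong) (simp add: job_order)
    show ?thesis
      unfolding started_def test_first_def first second using untested j by simp
  next
    case False
    \<comment> \<open>The two second phases may differ, but neither is visible at time
      \<open>\<tau>\<close>.\<close>
    have "\<tau> < snd (second_phase m \<alpha> I j)" "\<tau> < snd (second_phase m \<alpha> I' j)"
      using second_phase_bounds(3)[OF m valid(1) j, of \<alpha>]
        second_phase_bounds(3)[OF m valid(2), of j \<alpha>] j n finish False
      by (metis order_less_le_trans not_le prod.collapse)+
    then show ?thesis
      using untested j by (auto simp: started_def test_first_def first split: prod.splits)
  qed
qed

section \<open>Competitive analysis for uniform testing times\<close>

text \<open>The work of \<open>i\<close> charged to the waiting time of \<open>j\<close>. A tested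
  job waits for the whole first phase, hence for the first task of every other job.\<close>

definition delay :: "real \<Rightarrow> testing_instance \<Rightarrow> nat \<Rightarrow> nat \<Rightarrow> real" where
  "delay \<alpha> I j i =
     (if untested \<alpha> I j then if ahead (upper_limit I) i j then first_length \<alpha> I i else 0
      else first_length \<alpha> I i +
        (if ahead (second_length \<alpha> I) i j then second_length \<alpha> I i else 0))"

definition own_length :: "real \<Rightarrow> testing_instance \<Rightarrow> nat \<Rightarrow> real" where
  "own_length \<alpha> I j =
     (if untested \<alpha> I j then upper_limit I j else test_time I j + proc_time I j)"

lemma not_ahead_refl: "\<not> ahead f j j"
  by (simp add: ahead_def)

context
  fixes m :: nat and \<alpha> t :: real and I :: testing_instance
  assumes m: "1 \<le> m" and \<alpha>: "1 \<le> \<alpha>" and valid: "valid_instance I"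
    and t: "0 < t" and uniform: "\<And>j. j < njobs I \<Longrightarrow> test_time I j = t"
begin

text \<open>All machines are busy until the last test starts, so waiting for the end of that test costs
  at most \<open>t\<close> on each machine other than the one that runs it.\<close>

lemma sum_second_load_le:
  "(\<Sum>i<m. second_load m \<alpha> I i) \<le> (\<Sum>j<njobs I. first_length \<alpha> I j) + (real m - 1) * t"
proof -
  let ?F = "final_load m (first_length \<alpha> I) (\<lambda>_. 0) (job_order (upper_limit I) (njobs I))"
  have F: "(\<Sum>i<m. ?F i) = (\<Sum>j<njobs I. first_length \<alpha> I j)"
    using sum_final_load[OF m job_order(2)] by (simp add: job_order)
  have F_nonneg: "0 \<le> ?F i" for i
    using final_load_ge[of "job_order (upper_limit I) (njobs I)" "first_length \<alpha> I" "\<lambda>_. 0" i]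
      first_length_nonneg[OF m valid] by (simp add: job_order)
  have "tests_done m \<alpha> I \<in> insert 0 ((\<lambda>j. snd (first_phase m \<alpha> I j) + test_time I j) `
     {j. j < njobs I \<and> \<not> untested \<alpha> I j})"
    unfolding tests_done_def by (intro Max_in) auto
  then consider "tests_done m \<alpha> I = 0"
    | j where "j < njobs I" "\<not> untested \<alpha> I j"
      "tests_done m \<alpha> I = snd (first_phase m \<alpha> I j) + test_time I j"
    by blast
  then show ?thesis
  proof cases
    case 1
    then have "(\<Sum>i<m. second_load m \<alpha> I i) = (\<Sum>i<m. ?F i)"
      using F_nonneg by (simp add: second_load_def max_def)
    moreover have "0 \<le> (real m - 1) * t"
      using m t by simp
    ultimately show ?thesis
      using F by simp
  next
    case 2
    obtain i0 s where s: "first_phase m \<alpha> I j = (i0, s)"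
      by fastforce
    have T: "tests_done m \<alpha> I = s + t"
      using 2 s uniform by simp
    have b: "i0 < m \<and> s + first_length \<alpha> I j \<le> ?F i0 \<and> (\<forall>i<m. s \<le> ?F i)"
      using list_schedule_bounds[OF m job_order(2) _ _ s[unfolded first_phase_def]]
        first_length_nonneg[OF m valid] 2(1) by (simp add: job_order)
    \<comment> \<open>The load of \<open>i0\<close> already includes the last test; elsewhere
      \<open>s \<le> ?F i\<close>, so raising the load to \<open>s + t\<close> adds at most
      \<open>t\<close>.\<close>
    have "(\<Sum>i<m. second_load m \<alpha> I i) \<le> (\<Sum>i<m. ?F i + (if i = i0 then 0 else t))"
    proof (intro sum_mono)
      fix i assume "i \<in> {..<m}"
      then show "second_load m \<alpha> I i \<le> ?F i + (if i = i0 then 0 else t)"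
        using b t 2 uniform by (auto simp: second_load_def T first_length_def)
    qed
    also have "\<dots> = (\<Sum>i<m. ?F i) + (\<Sum>i<m. t - (if i = i0 then t else 0))"
      unfolding sum.distrib by (intro arg_cong2[where f = "(+)"] sum.cong) auto
    also have "(\<Sum>i<m. t - (if i = i0 then t else 0)) = (real m - 1) * t"
      using b by (simp add: sum_subtractf algebra_simps)
    finally show ?thesis
      using F by simp
  qed
qed

text \<open>This is \<open>list_schedule_start_le\<close> for the phase that completes
  \<open>j\<close>, with the work of \<open>j\<close> itself separated from that of the
  others.\<close>

lemma completion_time_test_first_le:
  assumes j: "j < njobs I"
  shows "real m * completion_time I j (test_first m \<alpha> I j) \<le>
    (\<Sum>i\<in>{..<njobs I} - {j}. delay \<alpha> I j i) + real m * own_length \<alpha> I j"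
proof -
  have ahead_sum: "(\<Sum>i | i < njobs I \<and> ahead f i j. g i) =
      (\<Sum>i\<in>{..<njobs I} - {j}. if ahead f i j then g i else 0)" for f g :: "nat \<Rightarrow> real"
  proof -
    have "{i. i < njobs I \<and> ahead f i j} = {i \<in> {..<njobs I} - {j}. ahead f i j}"
      using not_ahead_refl by auto
    then show ?thesis
      using sum.inter_filter[of "{..<njobs I} - {j}" g "\<lambda>i. ahead f i j"] by simp
  qed
  obtain i1 s1 where 1: "first_phase m \<alpha> I j = (i1, s1)"
    by fastforce
  obtain i2 s2 where 2: "second_phase m \<alpha> I j = (i2, s2)"
    by fastforce
  show ?thesis
  proof (cases "untested \<alpha> I j")
    case True
    have "real m * s1 \<le> (\<Sum>i | i < njobs I \<and> ahead (upper_limit I) i j. first_length \<alpha> I i)"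
      using list_schedule_start_le[OF m job_order(2) sorted_wrt_job_order _ _
          1[unfolded first_phase_def]] first_length_nonneg[OF m valid] j by (simp add: job_order)
    then show ?thesis
      using True 1 by (simp add: ahead_sum test_first_def delay_def own_length_def algebra_simps)
  next
    case False
    have "real m * s2 \<le> (\<Sum>i<m. second_load m \<alpha> I i) +
        (\<Sum>i | i < njobs I \<and> ahead (second_length \<alpha> I) i j. second_length \<alpha> I i)"
      using list_schedule_start_le[OF m job_order(2) sorted_wrt_job_order _ _
          2[unfolded second_phase_def]] second_length_nonneg[OF m valid] j by (simp add: job_order)
    \<comment> \<open>The test of \<open>j\<close> contributes \<open>t\<close> and the wait for the
      last test \<open>(m - 1) * t\<close>; together they are exactly \<open>m\<close> times the
      test of \<open>j\<close>, which \<open>own_length\<close> accounts for.\<close>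
    moreover have "(\<Sum>i<njobs I. first_length \<alpha> I i) =
        t + (\<Sum>i\<in>{..<njobs I} - {j}. first_length \<alpha> I i)"
      using j False uniform by (simp add: sum.remove first_length_def)
    moreover note sum_second_load_le
    ultimately show ?thesis
      using False 1 2 j uniform
      by (simp add: ahead_sum test_first_def delay_def own_length_def sum.distrib algebra_simps)
  qed
qed

text \<open>Only a choice that differs from the optimal one loses: an untested job has
  \<open>u < \<alpha> * t\<close>, a tested one has \<open>t \<le> u / \<alpha>\<close> and
  \<open>p \<le> u\<close>. The factor is left general because both \<open>r\<close> and
  \<open>R\<close> are used for it.\<close>

lemma own_length_le:
  assumes "j < njobs I" "\<alpha> \<le> r" "1 + 1 / \<alpha> \<le> r"
  shows "own_length \<alpha> I j \<le> r * opt_length I j"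
proof -
  let ?u = "upper_limit I j" and ?p = "proc_time I j"
  have up: "0 \<le> ?p" "?p \<le> ?u"
    using valid assms(1) by (auto simp: valid_instance_def)
  have r: "1 \<le> r"
    using \<alpha> assms by simp
  show ?thesis
  proof (cases "untested \<alpha> I j")
    case True
    have "?u \<le> \<alpha> * t"
      using True assms uniform by (simp add: untested_def)
    also have "\<dots> \<le> r * (t + ?p)"
      using \<alpha> assms t up by (intro mult_mono) auto
    finally show ?thesis
      using True r up mult_right_mono[of 1 r ?u] assms uniform
      by (auto simp: own_length_def opt_length_def min_def)
  next
    case False
    then have "t \<le> ?u / \<alpha>"
      using \<alpha> assms uniform by (simp add: untested_def field_simps)
    then have "t + ?p \<le> (1 + 1 / \<alpha>) * ?u"
      using up by (simp add: algebra_simps)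
    also have "\<dots> \<le> r * ?u"
      using assms up by (intro mult_right_mono) auto
    finally show ?thesis
      using False r up t mult_right_mono[of 1 r "t + ?p"] assms uniform
      by (auto simp: own_length_def opt_length_def min_def)
  qed
qed

text \<open>The pair costs the smaller upper limit if both jobs are untested, the upper limit of the
  untested job if one is, and \<open>2 * t\<close> plus the smaller processing time if both are
  tested. The last value gives the constants 2 (against \<open>t + p\<close>) and
  \<open>1 + 2 / \<alpha>\<close> (against \<open>u\<close>).\<close>

lemma delay_pair_le:
  assumes ij: "i < njobs I" "j < njobs I" "i \<noteq> j"
    and R: "2 \<le> R" "\<alpha> \<le> R" "1 + 2 / \<alpha> \<le> R"
  shows "delay \<alpha> I j i + delay \<alpha> I i j \<le> R * min (opt_length I i) (opt_length I j)"
proof -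
  have up: "0 \<le> proc_time I k" "proc_time I k \<le> upper_limit I k" if "k < njobs I" for k
    using valid that by (auto simp: valid_instance_def)
  have small: "upper_limit I k \<le> R * opt_length I k" if "k < njobs I" "untested \<alpha> I k" for k
  proof -
    have "1 + 1 / \<alpha> \<le> 1 + 2 / \<alpha>"
      using \<alpha> by (simp add: divide_right_mono)
    then show ?thesis
      using own_length_le[OF that(1), of R] R that by (simp add: own_length_def)
  qed
  \<comment> \<open>The first bound serves mixed pairs, where \<open>\<alpha> * t\<close> exceeds
    the upper limit of the untested partner; the second serves pairs of tested jobs.\<close>
  have large: "\<alpha> * t \<le> R * opt_length I k" "2 * t + proc_time I k \<le> R * opt_length I k"
    if k: "k < njobs I" "\<not> untested \<alpha> I k" for k
  proof -
    let ?u = "upper_limit I k" and ?p = "proc_time I k"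
    have "\<alpha> * t \<le> ?u"
      using k uniform by (simp add: untested_def)
    then have tu: "2 * t \<le> 2 / \<alpha> * ?u"
      using \<alpha> by (simp add: field_simps)
    have "t \<le> \<alpha> * t"
      using \<alpha> t by simp
    then have "t \<le> ?u"
      using \<open>\<alpha> * t \<le> ?u\<close> by linarith
    then have "t \<le> opt_length I k"
      using up k uniform by (simp add: opt_length_def)
    then show "\<alpha> * t \<le> R * opt_length I k"
      using R \<alpha> t by (intro mult_mono) auto
    have "2 * t + ?p \<le> (1 + 2 / \<alpha>) * ?u"
      using tu up[OF k(1)] by (simp add: algebra_simps)
    also have "\<dots> \<le> R * ?u"
      using R up[OF k(1)] by (intro mult_right_mono) auto
    finally have "2 * t + ?p \<le> R * ?u" .
    moreover have "2 * t + ?p \<le> R * (t + ?p)"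
      using R up[of k] k t mult_right_mono[of 2 R "t + ?p"] by simp
    ultimately show "2 * t + ?p \<le> R * opt_length I k"
      using k uniform by (simp add: opt_length_def min_def)
  qed
  have mixed: "delay \<alpha> I l k + delay \<alpha> I k l \<le> R * min (opt_length I k) (opt_length I l)"
    if kl: "k < njobs I" "l < njobs I" "untested \<alpha> I k" "\<not> untested \<alpha> I l" for k l
  proof -
    have "upper_limit I k < \<alpha> * t" "\<alpha> * t \<le> upper_limit I l"
      using kl uniform by (auto simp: untested_def)
    then have "delay \<alpha> I l k + delay \<alpha> I k l = upper_limit I k"
      using kl by (simp add: delay_def ahead_def first_length_def second_length_def)
    then show ?thesis
      using small[of k] large(1)[of l] kl \<open>upper_limit I k < \<alpha> * t\<close> by (auto simp: min_def)
  qed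
  consider "untested \<alpha> I i" "untested \<alpha> I j" | "untested \<alpha> I i" "\<not> untested \<alpha> I j"
    | "\<not> untested \<alpha> I i" "untested \<alpha> I j" | "\<not> untested \<alpha> I i" "\<not> untested \<alpha> I j"
    by blast
  then show ?thesis
  proof cases
    case 1
    then have "delay \<alpha> I j i + delay \<alpha> I i j = min (upper_limit I i) (upper_limit I j)"
      using ij by (auto simp: delay_def ahead_def first_length_def)
    then show ?thesis
      using small[of i] small[of j] 1 ij by (auto simp: min_def)
  next
    case 2
    then show ?thesis
      using mixed ij by blast
  next
    case 3
    then show ?thesis
      using mixed[of j i] ij by (simp add: min.commute add.commute)
  next
    case 4
    then have "delay \<alpha> I j i + delay \<alpha> I i j = 2 * t + min (proc_time I i) (proc_time I j)"
      using ij uniform by (auto simp: delay_def ahead_def first_length_def second_length_def)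
    then show ?thesis
      using large(2)[of i] large(2)[of j] 4 ij by (auto simp: min_def)
  qed
qed

text \<open>Adding the delays to their transpose leaves one instance of \<open>delay_pair_le\<close>
  per ordered pair; the missing diagonal subtracts \<open>R\<close> times the sum of the
  \<open>opt_length\<close> values.\<close>

lemma cost_test_first_le:
  assumes R: "2 \<le> R" "\<alpha> \<le> R" "1 + 2 / \<alpha> \<le> R" and r: "\<alpha> \<le> r" "1 + 1 / \<alpha> \<le> r"
  shows "2 * real m * cost I (test_first m \<alpha> I) \<le>
    R * (\<Sum>i<njobs I. \<Sum>j<njobs I. min (opt_length I i) (opt_length I j)) +
    (R + 2 * (real m - 1) * r) * (\<Sum>j<njobs I. opt_length I j)"
proof -
  let ?J = "{..<njobs I}" and ?q = "opt_length I"
  have off: "(\<Sum>i\<in>?J - {j}. f j i) = (\<Sum>i\<in>?J. if i \<noteq> j then f j i else 0)"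
    for j and f :: "nat \<Rightarrow> nat \<Rightarrow> real"
    by (intro sum.mono_neutral_cong_left) auto
  have "2 * (\<Sum>j\<in>?J. \<Sum>i\<in>?J - {j}. delay \<alpha> I j i) =
      (\<Sum>j\<in>?J. \<Sum>i\<in>?J. if i \<noteq> j then delay \<alpha> I j i else 0) +
      (\<Sum>j\<in>?J. \<Sum>i\<in>?J. if j \<noteq> i then delay \<alpha> I i j else 0)"
    unfolding off by (subst (3) sum.swap) simp
  also have "\<dots> = (\<Sum>j\<in>?J. \<Sum>i\<in>?J. if i \<noteq> j then delay \<alpha> I j i + delay \<alpha> I i j else 0)"
    unfolding sum.distrib[symmetric] by (intro sum.cong) auto
  also have "\<dots> \<le> (\<Sum>j\<in>?J. \<Sum>i\<in>?J. R * min (?q i) (?q j) - (if i = j then R * ?q j else 0))"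
    using delay_pair_le[OF _ _ _ R] by (intro sum_mono) auto
  also have "\<dots> = R * (\<Sum>i\<in>?J. \<Sum>j\<in>?J. min (?q i) (?q j)) - R * (\<Sum>j\<in>?J. ?q j)"
    by (simp add: sum_subtractf sum_distrib_left min.commute)
  finally have pairs: "2 * (\<Sum>j\<in>?J. \<Sum>i\<in>?J - {j}. delay \<alpha> I j i) \<le>
    R * (\<Sum>i\<in>?J. \<Sum>j\<in>?J. min (?q i) (?q j)) - R * (\<Sum>j\<in>?J. ?q j)" .
  have "1 + 1 / \<alpha> \<le> 1 + 2 / \<alpha>"
    using \<alpha> by (simp add: divide_right_mono)
  \<comment> \<open>Of the \<open>m\<close> copies of the own lengths, one is bounded with
    \<open>R\<close>, to complete the one-machine optimum, and the other \<open>m - 1\<close> with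
    \<open>r\<close>.\<close>
  then have "(\<Sum>j\<in>?J. own_length \<alpha> I j) \<le> (\<Sum>j\<in>?J. R * ?q j)"
    using R by (intro sum_mono own_length_le) auto
  moreover have "(\<Sum>j\<in>?J. own_length \<alpha> I j) \<le> (\<Sum>j\<in>?J. r * ?q j)"
    using r by (intro sum_mono own_length_le) auto
  then have "(real m - 1) * (\<Sum>j\<in>?J. own_length \<alpha> I j) \<le> (real m - 1) * (\<Sum>j\<in>?J. r * ?q j)"
    using m by (intro mult_left_mono) auto
  moreover have "real m * cost I (test_first m \<alpha> I) \<le>
      (\<Sum>j\<in>?J. \<Sum>i\<in>?J - {j}. delay \<alpha> I j i) + real m * (\<Sum>j\<in>?J. own_length \<alpha> I j)"
    unfolding cost_def sum_distrib_left sum.distrib[symmetric]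
    by (intro sum_mono completion_time_test_first_le) simp
  ultimately show ?thesis
    using pairs by (simp add: algebra_simps sum_distrib_left[symmetric])
qed

lemma cost_test_first_le_opt_cost:
  assumes R: "2 \<le> R" "\<alpha> \<le> R" "1 + 2 / \<alpha> \<le> R" and r: "\<alpha> \<le> r" "1 + 1 / \<alpha> \<le> r"
    and "R \<le> 2 * r"
  shows "cost I (test_first m \<alpha> I) \<le>
    (R * (1 / 2 + 1 / (2 * real m)) + r * (1 - 1 / real m)) * opt_cost m I"
proof -
  define c where "c = R * (1 / 2 + 1 / (2 * real m)) + r * (1 - 1 / real m)"
  have "0 < R * (1 / 2 + 1 / (2 * real m))" "0 \<le> r * (1 - 1 / real m)"
    using R r \<alpha> m by (auto intro!: mult_pos_pos add_pos_nonneg mult_nonneg_nonneg)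
  then have c: "0 < c"
    by (simp add: c_def)
  \<comment> \<open>\<open>opt_cost\<close> is an infimum, so the bound is proved against every
    feasible schedule, with \<open>c\<close> moved to the left.\<close>
  have "cost I (test_first m \<alpha> I) / c \<le> opt_cost m I"
    unfolding opt_cost_def
  proof (rule cInf_greatest)
    show "{cost I S |S. feasible m I S} \<noteq> {}"
      using feasible_exists[OF valid m] by blast
    fix x assume "x \<in> {cost I S |S. feasible m I S}"
    then obtain S where x: "x = cost I S" and S: "feasible m I S"
      by blast
    let ?q = "opt_length I"
    let ?M = "\<Sum>i<njobs I. \<Sum>j<njobs I. min (?q i) (?q j)" and ?Q = "\<Sum>j<njobs I. ?q j"
    have "2 * real m * cost I (test_first m \<alpha> I) \<le> R * ?M + (R + 2 * (real m - 1) * r) * ?Q"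
      by (rule cost_test_first_le) fact+
    \<comment> \<open>The terms are regrouped to fit the two lower bounds;
      \<open>R \<le> 2 * r\<close> makes the second coefficient nonnegative.\<close>
    also have "\<dots> = R * (?M + real m * ?Q) + (real m - 1) * (2 * r - R) * ?Q"
      by (simp add: algebra_simps)
    also have "\<dots> \<le> R * (2 * real m * x) + (real m - 1) * (2 * r - R) * x"
      using cost_ge_pairwise_minima[OF valid S] cost_ge_sum_opt_length[OF valid S] R m assms(6)
      unfolding x by (intro add_mono mult_left_mono) auto
    also have "\<dots> = 2 * real m * (c * x)"
      using m by (simp add: c_def field_simps)
    finally have "cost I (test_first m \<alpha> I) \<le> c * x"
      using m by simp
    then show "cost I (test_first m \<alpha> I) / c \<le> x"
      using c by (simp add: pos_divide_le_eq mult.commute)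
  qed
  then show ?thesis
    unfolding c_def[symmetric] using c by (simp add: pos_divide_le_eq mult.commute)
qed

end

theorem theorem21:
  fixes m :: nat and \<alpha> :: real
  assumes "1 \<le> m" and "1 \<le> \<alpha>"
    and "Max {2, \<alpha>, 1 + 2 / \<alpha>} \<le> 2 * max \<alpha> (1 + 1 / \<alpha>)"
  shows "\<exists>A. online_algorithm m A \<and>
    competitive_on uniform_tests m
      (Max {2, \<alpha>, 1 + 2 / \<alpha>} * (1 / 2 + 1 / (2 * real m))
        + max \<alpha> (1 + 1 / \<alpha>) * (1 - 1 / real m)) A"
proof (intro exI conjI)
  show "online_algorithm m (test_first m \<alpha>)"
    unfolding online_algorithm_def
    using feasible_test_first[OF assms(1)] non_anticipating_test_first[OF assms(1)] by blast
  show "competitive_on uniform_tests m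
      (Max {2, \<alpha>, 1 + 2 / \<alpha>} * (1 / 2 + 1 / (2 * real m))
        + max \<alpha> (1 + 1 / \<alpha>) * (1 - 1 / real m)) (test_first m \<alpha>)"
    unfolding competitive_on_def
  proof (intro ballI impI)
    fix I assume I: "I \<in> uniform_tests" "valid_instance I"
    obtain t where t: "0 < t" "\<And>j. j < njobs I \<Longrightarrow> test_time I j = t"
    proof (cases "njobs I = 0")
      \<comment> \<open>Without jobs there is no common testing time, and any positive
        \<open>t\<close> will do.\<close>
      case True
      then show ?thesis
        using that[of 1] by simp
    next
      case False
      then have "0 < test_time I 0" "\<And>j. j < njobs I \<Longrightarrow> test_time I j = test_time I 0"
        using I unfolding uniform_tests_def valid_instance_def by blast+
      then show ?thesis
        by (rule that)
    qed
    show "cost I (test_first m \<alpha> I) \<le>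
      (Max {2, \<alpha>, 1 + 2 / \<alpha>} * (1 / 2 + 1 / (2 * real m))
        + max \<alpha> (1 + 1 / \<alpha>) * (1 - 1 / real m)) * opt_cost m I"
      using assms t I by (intro cost_test_first_le_opt_cost) auto
  qed
qed

end
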